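(* Assume (H$_1$)–(H$_3$) (listed in the context). Let $(\overline\rho,\overline u,\overline\theta,\overline\eta)$ be a constant state with $\overline\rho,\overline\theta,\overline\eta>0$ and $\overline\eta=\overline\theta^4$. Then the one-dimensional linear system $\overline A^0V_t+\overline A^1V_x+\overline LV=\overline BV_{xx}$, with the constant matrices given in the context, satisfies the genuine coupling condition: for every $\psi\in\mathbb{R}^4$, $\psi\ne0$, with $\overline B\psi=\overline L\psi=0$, one has $\mu\overline A^0\psi+\overline A^1\psi\ne0$ for every $\mu\in\mathbb{R}$.
   Context: A bar over a thermodynamic function denotes evaluation at $(\overline\rho,\overline\theta)$. The matrices are $$\overline A^0=\mathrm{diag}\big(\overline\theta\,\overline p_\rho\overline\eta/\overline\rho,\ \overline\rho\,\overline\theta\,\overline\eta,\ \overline\rho\,\overline e_\theta\overline\eta,\ \overline\theta/4\big),\qquad \overline B=\mathrm{diag}\big(0,0,0,\overline\theta/(12\sigma_s)\big),$$ $$\overline L=\begin{pmatrix}0&0&0&0\\0&0&0&0\\0&0&4\sigma_a\overline\theta^3\overline\eta&-\sigma_a\overline\eta\\0&0&-\sigma_a\overline\eta&\sigma_a\overline\theta/4\end{pmatrix},$$ $$\overline A^1=\begin{pmatrix}\overline u\,\overline\theta\,\overline\eta\,\overline p_\rho/\overline\rho&\overline\theta\,\overline\eta\,\overline p_\rho&0&0\\ \overline\theta\,\overline\eta\,\overline p_\rho&\overline\rho\,\overline u\,\overline\theta\,\overline\eta&\overline\theta\,\overline\eta\,\overline p_\theta&\overline\theta\,\overline\eta/3\\0&\overline\theta\,\overline\eta\,\overline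 p_\theta&\overline\rho\,\overline u\,\overline\eta\,\overline e_\theta&0\\0&\overline\theta\,\overline\eta/3&0&\overline u\,\overline\theta/4\end{pmatrix}.$$ This is the symmetrized linearization, around the equilibrium state and in the variables $V=(\rho,u,\theta,\eta)$, of the one-dimensional non-equilibrium radiation hydrodynamics system. Assumptions: (H$_1$) the independent thermodynamic variables $(\rho,\theta)$ take values in $\mathcal D=\{\rho>0,\theta>0\}$. (H$_2$) the pressure $p$, internal energy $e$ and specific entropy $s$ of the fluid are $C^\infty$ functions on $\mathcal D$ with $p>0$, $p_\rho>0$, $p_\theta>0$, $e_\theta>0$, satisfying $de=\theta\,ds-p\,d(1/\rho)$. (H$_3$) $\sigma_a,\sigma_s$ are positive constants. *)

theory Defs
  imports "HOL-Analysis.Analysis"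
begin

section \<open>Smooth functions on an open set\<close>

text \<open>
  \<open>Ck_on k S f\<close>: \<open>f\<close> is of class \<open>C\<^sup>k\<close> on the open set \<open>S\<close>, i.e. all iterated directional
  derivatives up to order \<open>k\<close> are continuous.
\<close>

primrec Ck_on :: "nat \<Rightarrow> 'a::real_normed_vector set \<Rightarrow> ('a \<Rightarrow> 'b::real_normed_vector) \<Rightarrow> bool" where
  "Ck_on 0 S f \<longleftrightarrow> continuous_on S f"
| "Ck_on (Suc k) S f \<longleftrightarrow>
     (\<forall>x\<in>S. f differentiable (at x)) \<and> (\<forall>v. Ck_on k S (\<lambda>x. frechet_derivative f (at x) v))"

definition smooth_on :: "'a::real_normed_vector set \<Rightarrow> ('a \<Rightarrow> 'b::real_normed_vector) \<Rightarrow> bool" where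
  "smooth_on S f \<longleftrightarrow> (\<forall>k. Ck_on k S f)"

section \<open>Thermodynamics of the fluid\<close>

text \<open>Thermodynamic functions take the pair \<open>(\<rho>, \<theta>)\<close> as argument.\<close>

definition thermo_domain :: "(real \<times> real) set" where
  "thermo_domain = {(\<rho>, \<theta>). \<rho> > 0 \<and> \<theta> > 0}"

definition d_rho :: "(real \<times> real \<Rightarrow> real) \<Rightarrow> real \<times> real \<Rightarrow> real" where
  "d_rho f x = deriv (\<lambda>r. f (r, snd x)) (fst x)"

definition d_theta :: "(real \<times> real \<Rightarrow> real) \<Rightarrow> real \<times> real \<Rightarrow> real" where
  "d_theta f x = deriv (\<lambda>t. f (fst x, t)) (snd x)"

text \<open>
  The assumption \<open>gibbs\<close> is \<open>de = \<theta> ds - p d(1/\<rho>)\<close> as an identity of differential forms,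
  evaluated at a point \<open>x = (\<rho>, \<theta>)\<close> and a tangent vector \<open>h\<close>.
\<close>

locale fluid_thermodynamics =
  fixes p e s :: "real \<times> real \<Rightarrow> real"
  assumes smooth_p: "smooth_on thermo_domain p"
    and smooth_e: "smooth_on thermo_domain e"
    and smooth_s: "smooth_on thermo_domain s"
    and p_pos: "\<And>x. x \<in> thermo_domain \<Longrightarrow> p x > 0"
    and p_rho_pos: "\<And>x. x \<in> thermo_domain \<Longrightarrow> d_rho p x > 0"
    and p_theta_pos: "\<And>x. x \<in> thermo_domain \<Longrightarrow> d_theta p x > 0"
    and e_theta_pos: "\<And>x. x \<in> thermo_domain \<Longrightarrow> d_theta e x > 0"
    and gibbs: "\<And>x h. x \<in> thermo_domain \<Longrightarrow>
      frechet_derivative e (at x) h =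
        snd x * frechet_derivative s (at x) h
        - p x * frechet_derivative (\<lambda>y. 1 / fst y) (at x) h"

section \<open>The linearized radiation hydrodynamics system\<close>

text \<open>
  Coefficient matrices at a state \<open>(\<rho>, u, \<theta>, \<eta>)\<close>, in this order of the variables; each inner
  list is a row.
\<close>

definition A0_mat ::
  "(real \<times> real \<Rightarrow> real) \<Rightarrow> (real \<times> real \<Rightarrow> real) \<Rightarrow> real \<Rightarrow> real \<Rightarrow> real \<Rightarrow> real ^ 4 ^ 4" where
  "A0_mat p e \<rho> \<theta> \<eta> = vector
    [vector [\<theta> * d_rho p (\<rho>, \<theta>) * \<eta> / \<rho>, 0, 0, 0],
     vector [0, \<rho> * \<theta> * \<eta>, 0, 0],
     vector [0, 0, \<rho> * d_theta e (\<rho>, \<theta>) * \<eta>, 0],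
     vector [0, 0, 0, \<theta> / 4]]"

definition A1_mat ::
  "(real \<times> real \<Rightarrow> real) \<Rightarrow> (real \<times> real \<Rightarrow> real) \<Rightarrow> real \<Rightarrow> real \<Rightarrow> real \<Rightarrow> real \<Rightarrow> real ^ 4 ^ 4" where
  "A1_mat p e \<rho> u \<theta> \<eta> = vector
    [vector [u * \<theta> * \<eta> * d_rho p (\<rho>, \<theta>) / \<rho>, \<theta> * \<eta> * d_rho p (\<rho>, \<theta>), 0, 0],
     vector [\<theta> * \<eta> * d_rho p (\<rho>, \<theta>), \<rho> * u * \<theta> * \<eta>, \<theta> * \<eta> * d_theta p (\<rho>, \<theta>), \<theta> * \<eta> / 3],
     vector [0, \<theta> * \<eta> * d_theta p (\<rho>, \<theta>), \<rho> * u * \<eta> * d_theta e (\<rho>, \<theta>), 0],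
     vector [0, \<theta> * \<eta> / 3, 0, u * \<theta> / 4]]"

definition L_mat :: "real \<Rightarrow> real \<Rightarrow> real \<Rightarrow> real ^ 4 ^ 4" where
  "L_mat \<sigma>\<^sub>a \<theta> \<eta> = vector
    [vector [0, 0, 0, 0],
     vector [0, 0, 0, 0],
     vector [0, 0, 4 * \<sigma>\<^sub>a * \<theta> ^ 3 * \<eta>, - \<sigma>\<^sub>a * \<eta>],
     vector [0, 0, - \<sigma>\<^sub>a * \<eta>, \<sigma>\<^sub>a * \<theta> / 4]]"

definition B_mat :: "real \<Rightarrow> real \<Rightarrow> real ^ 4 ^ 4" where
  "B_mat \<sigma>\<^sub>s \<theta> = vector
    [vector [0, 0, 0, 0],
     vector [0, 0, 0, 0],
     vector [0, 0, 0, 0],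
     vector [0, 0, 0, \<theta> / (12 * \<sigma>\<^sub>s)]]"

text \<open>Genuine coupling condition for the system \<open>A0 V\<^sub>t + A1 V\<^sub>x + L V = B V\<^sub>x\<^sub>x\<close>.\<close>

definition genuinely_coupled ::
  "real ^ 'n ^ 'n \<Rightarrow> real ^ 'n ^ 'n \<Rightarrow> real ^ 'n ^ 'n \<Rightarrow> real ^ 'n ^ 'n \<Rightarrow> bool" where
  "genuinely_coupled A0 A1 L B \<longleftrightarrow>
     (\<forall>\<psi>. \<psi> \<noteq> 0 \<and> B *v \<psi> = 0 \<and> L *v \<psi> = 0 \<longrightarrow>
       (\<forall>\<mu>. \<mu> *\<^sub>R (A0 *v \<psi>) + A1 *v \<psi> \<noteq> 0))"

end

theory Submission
  imports Defs
begin

text \<open>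
  The kernel of \<open>B\<close> is \<open>{\<psi>. \<psi>\<^sub>4 = 0}\<close>, since scattering makes the radiation component diffuse, and
  on it the absorption terms of \<open>L\<close> force \<open>\<psi>\<^sub>3 = 0\<close>. So only a density component \<open>\<psi>\<^sub>1\<close> and a velocity
  component \<open>\<psi>\<^sub>2\<close> can escape dissipation. Such a vector is never an eigenvector of the convective
  part: in \<open>\<mu> A\<^sup>0 \<psi> + A\<^sup>1 \<psi>\<close>, for every \<open>\<mu>\<close>, the temperature component is \<open>\<theta> \<eta> p\<^sub>\<theta> \<psi>\<^sub>2\<close>, because \<open>A\<^sup>0\<close> and
  the transport part of \<open>A\<^sup>1\<close> are diagonal; if it vanishes then \<open>\<psi>\<^sub>2 = 0\<close> as \<open>p\<^sub>\<theta> > 0\<close>, and the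
  velocity component reduces to \<open>\<theta> \<eta> p\<^sub>\<rho> \<psi>\<^sub>1\<close> with \<open>p\<^sub>\<rho> > 0\<close>, whence \<open>\<psi>\<^sub>1 = 0\<close>.
\<close>

lemma vector_4:
  "(vector [w, x, y, z] :: ('a::zero) ^ 4) $ 1 = w"
  "(vector [w, x, y, z] :: ('a::zero) ^ 4) $ 2 = x"
  "(vector [w, x, y, z] :: ('a::zero) ^ 4) $ 3 = y"
  "(vector [w, x, y, z] :: ('a::zero) ^ 4) $ 4 = z"
  unfolding vector_def by simp_all

lemma matrix_vector_mult_4:
  fixes M :: "real ^ 4 ^ 'n"
  shows "(M *v x) $ i = M $ i $ 1 * x $ 1 + M $ i $ 2 * x $ 2 + M $ i $ 3 * x $ 3 + M $ i $ 4 * x $ 4"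
  by (simp add: matrix_vector_mult_def sum_4)

text \<open>
  Absorption couples temperature and radiation, so \<open>L\<close> alone may well annihilate vectors with both
  components nonzero (the linearized radiative equilibria); it is scattering, through \<open>B\<close>, that
  removes the radiation component and lets the exchange term remove the temperature.
\<close>

lemma dissipation_kernel:
  assumes "\<sigma>\<^sub>a \<noteq> 0" and "\<sigma>\<^sub>s \<noteq> 0" and "\<theta> \<noteq> 0" and "\<eta> \<noteq> 0"
    and B: "B_mat \<sigma>\<^sub>s \<theta> *v \<psi> = 0" and L: "L_mat \<sigma>\<^sub>a \<theta> \<eta> *v \<psi> = 0"
  shows "\<psi> $ 3 = 0" and "\<psi> $ 4 = 0"
proof -
  have "(B_mat \<sigma>\<^sub>s \<theta> *v \<psi>) $ 4 = 0"
    using B by simp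
  then show "\<psi> $ 4 = 0"
    using assms(2,3) by (simp add: matrix_vector_mult_4 B_mat_def vector_4)
  moreover have "(L_mat \<sigma>\<^sub>a \<theta> \<eta> *v \<psi>) $ 4 = 0"
    using L by simp
  ultimately show "\<psi> $ 3 = 0"
    using assms(1,4) by (simp add: matrix_vector_mult_4 L_mat_def vector_4)
qed

text \<open>
  The pressure gradient links density to velocity through \<open>p\<^sub>\<rho>\<close>, and compression links velocity to
  temperature through \<open>p\<^sub>\<theta>\<close>. The chain is followed backwards from the zero temperature component:
  the velocity must go first, since the velocity component of the equation contains
  \<open>\<rho> \<theta> \<eta> (\<mu> + u) \<psi>\<^sub>2\<close> next to the density term.
\<close>

lemma convection_leaves_dissipation_kernel:
  assumes "d_rho p (\<rho>, \<theta>) \<noteq> 0" and "d_theta p (\<rho>, \<theta>) \<noteq> 0" and "\<theta> \<noteq> 0" and "\<eta> \<noteq> 0"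
    and kernel: "\<psi> $ 3 = 0" "\<psi> $ 4 = 0"
    and eigen: "\<mu> *\<^sub>R (A0_mat p e \<rho> \<theta> \<eta> *v \<psi>) + A1_mat p e \<rho> u \<theta> \<eta> *v \<psi> = 0" (is "?w = 0")
  shows "\<psi> = 0"
proof -
  have "?w $ 3 = 0"
    unfolding eigen by simp
  then have "\<psi> $ 2 = 0"
    using assms(2-6) by (simp add: matrix_vector_mult_4 A0_mat_def A1_mat_def vector_4)
  moreover have "?w $ 2 = 0"
    unfolding eigen by simp
  ultimately have "\<psi> $ 1 = 0"
    using assms(1,3-6) by (simp add: matrix_vector_mult_4 A0_mat_def A1_mat_def vector_4)
  with \<open>\<psi> $ 2 = 0\<close> kernel show "\<psi> = 0"
    by (simp add: vec_eq_iff forall_4)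
qed

theorem lemma2p5:
  fixes p e s :: "real \<times> real \<Rightarrow> real"
    and \<sigma>\<^sub>a \<sigma>\<^sub>s \<rho> u \<theta> \<eta> :: real
  assumes "fluid_thermodynamics p e s"
    and "\<sigma>\<^sub>a > 0" and "\<sigma>\<^sub>s > 0"
    and "\<rho> > 0" and "\<theta> > 0" and "\<eta> > 0"
    and "\<eta> = \<theta> ^ 4"
  shows "genuinely_coupled (A0_mat p e \<rho> \<theta> \<eta>) (A1_mat p e \<rho> u \<theta> \<eta>)
    (L_mat \<sigma>\<^sub>a \<theta> \<eta>) (B_mat \<sigma>\<^sub>s \<theta>)"
proof -
  interpret fluid_thermodynamics p e s
    by fact
  have "(\<rho>, \<theta>) \<in> thermo_domain"
    using assms(4,5) by (simp add: thermo_domain_def)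
  then have p_derivs: "d_rho p (\<rho>, \<theta>) \<noteq> 0" "d_theta p (\<rho>, \<theta>) \<noteq> 0"
    using p_rho_pos p_theta_pos by (metis less_irrefl)+
  have nonzero: "\<sigma>\<^sub>a \<noteq> 0" "\<sigma>\<^sub>s \<noteq> 0" "\<theta> \<noteq> 0" "\<eta> \<noteq> 0"
    using assms(2,3,5,6) by simp_all
  show ?thesis
    unfolding genuinely_coupled_def
    using dissipation_kernel[OF nonzero]
      convection_leaves_dissipation_kernel[OF p_derivs nonzero(3,4)]
    by blast
qed

end
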